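(* Let $\mathcal{E}$ be a Euclidean vector space, $C \subseteq \mathcal{E}$ nonempty and closed, and $f : \mathcal{E} \to \mathbb{R}$ continuously differentiable on $C$. Consider a sequence generated by $\mathrm{PGD}$ applied to the problem $\min_{x \in C} f(x)$. \begin{itemize} \item If this sequence is finite, then its last element is B-stationary; if, in addition, $f$ is differentiable on $\mathcal{E}$ with $\nabla f : \mathcal{E} \to \mathcal{E}$ locally Lipschitz continuous, then its last element is even P-stationary. \item If this sequence is infinite, then all of its accumulation points, if any, are B-stationary; if, in addition, $f$ is differentiable on $\mathcal{E}$ with $\nabla f : \mathcal{E} \to \mathcal{E}$ locally Lipschitz continuous, then all of its accumulation points, if any, are even P-stationary. \end{itemize}
   Context: A Euclidean vector space is a finite-dimensional real inner product space, with inner product $\langle \cdot,\cdot\rangle$ and norm $\|\cdot\|$. $\mathbb{N}$ contains $0$. $f : \mathcal{E} \to \mathbb{R}$ is *continuously differentiable on $C$* if for every $x \in C$ there is a (unique) vector $\nabla f(x) \in \mathcal{E}$ with $\lim_{y \to x,\, y \in \mathcal{E}\setminus\{x\}} \frac{f(y)-f(x)-\langle \nabla f(x), y-x\rangle}{\|y-x\|} = 0$, and $\nabla f : C \to \mathcal{E}$ is continuous. Projection: for $z \in \mathcal{E}$, $P_C(z) = \operatorname{argmin}_{y \in C} \|z-y\|$ (a nonempty compact set). Tangent cone: $v \in T_C(x)$ ($x\in C$) if there are sequences $(x_i)_{i\in\mathbb{N}}$ in $C$ converging to $x$ and $(t_i)_{i\in\mathbb{N}}$ in $(0,\infty)$ with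 $\frac{x_i - x}{t_i} \to v$. Regular normal cone: $\widehat{N}_C(x) = \{v \in \mathcal{E} \mid \langle v,w\rangle \le 0 \ \forall w \in T_C(x)\}$. Proximal normal cone: $\widehat{\widehat{N}}_C(x) = \{v \in \mathcal{E} \mid \exists\, a \in (0,\infty) : x \in P_C(x + a v)\}$. A point $x \in C$ is B-stationary if $-\nabla f(x) \in \widehat{N}_C(x)$ and P-stationary if $-\nabla f(x) \in \widehat{\widehat{N}}_C(x)$. PGD map. Parameters: $0 < \underline{\alpha} \le \overline{\alpha} < \infty$ and $\beta, c \in (0,1)$. Input: $x \in C$ and $\mu \in [f(x),\infty)$. Choose $\alpha \in [\underline{\alpha},\overline{\alpha}]$ and $y \in P_C(x-\alpha\nabla f(x))$. While $f(y) > \mu + c\langle \nabla f(x), y-x\rangle$: replace $\alpha$ with $\alpha\beta$ and choose $y \in P_C(x-\alpha\nabla f(x))$. Return $y$. All choices are arbitrary; $\mathrm{PGD}(x,\mu)$ denotes the set of possible outputs. PGD algorithm. Additional parameter: either (``max'', $l$) with $l \in \mathbb{N}$ or (``average'', $p$) with $p \in (0,1]$. Input: $x_0 \in C$. Set $\mu_{-1} = f(x_0)$. For $i = 0,1,2,\dots$: if $-\nabla f(x_i) \in \widehat{N}_C(x_i)$, stop ($x_i$ is the last element of the sequence). Otherwise, set $\mu_i = \max_{j \in \{\max\{0,i-l\},\dots,i\}} f(x_j)$ (``max'' rule) or $\mu_i = (1-p)\mu_{i-1} + p f(x_i)$ (``average'' rule), and choose $x_{i+1} \in \mathrm{PGD}(x_i,\mu_i)$.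 If $f$ is differentiable on $\mathcal{E}$ with locally Lipschitz continuous gradient, then $\widehat{N}_C(x_i)$ is replaced with $\widehat{\widehat{N}}_C(x_i)$ in the stopping test. The generated sequence is finite if the algorithm stops and infinite otherwise. *)

theory Defs
  imports "HOL-Analysis.Analysis" "HOL-Library.Extended_Nat"
begin

text \<open>Gradients. \<open>GDERIV f x :> D\<close> is Frechet differentiability of \<open>f\<close> at \<open>x\<close> with respect to
  the whole space, with derivative \<open>h \<mapsto> h \<bullet> D\<close>. The value of \<open>grad f x\<close> is only meaningful where
  \<open>f\<close> is differentiable.\<close>

definition grad :: "('a::euclidean_space \<Rightarrow> real) \<Rightarrow> 'a \<Rightarrow> 'a" where
  "grad f x = (THE D. GDERIV f x :> D)"

lemma grad_eq:
  assumes "GDERIV f x :> D"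
  shows "grad f x = D"
proof -
  have "D' = D" if "GDERIV f x :> D'" for D'
  proof -
    have "(\<lambda>h. h \<bullet> D') = (\<lambda>h. h \<bullet> D)"
      using that assms unfolding gderiv_def by (rule has_derivative_unique)
    then show ?thesis
      using vector_eq_ldot[of D' D] by (auto dest: fun_cong)
  qed
  with assms show ?thesis
    unfolding grad_def by (rule the_equality[where P = "\<lambda>D. GDERIV f x :> D"])
qed

definition continuously_differentiable_on ::
    "'a::euclidean_space set \<Rightarrow> ('a \<Rightarrow> real) \<Rightarrow> bool" where
  "continuously_differentiable_on C f \<longleftrightarrow>
     (\<forall>x\<in>C. \<exists>D. GDERIV f x :> D) \<and> continuous_on C (grad f)"

definition locally_lipschitz_gradient :: "('a::euclidean_space \<Rightarrow> real) \<Rightarrow> bool" where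
  "locally_lipschitz_gradient f \<longleftrightarrow>
     (\<forall>x. \<exists>D. GDERIV f x :> D) \<and>
     (\<forall>x. \<exists>r>0. \<exists>L. L-lipschitz_on (ball x r) (grad f))"

definition projection :: "'a::euclidean_space set \<Rightarrow> 'a \<Rightarrow> 'a set" where
  "projection C z = {y. is_arg_min (\<lambda>y. norm (z - y)) (\<lambda>y. y \<in> C) y}"

definition tangent_cone :: "'a::euclidean_space set \<Rightarrow> 'a \<Rightarrow> 'a set" where
  "tangent_cone C x = {v. \<exists>(X :: nat \<Rightarrow> 'a) (t :: nat \<Rightarrow> real).
     (\<forall>i. X i \<in> C) \<and> X \<longlonglongrightarrow> x \<and> (\<forall>i. 0 < t i) \<and> (\<lambda>i. (X i - x) /\<^sub>R t i) \<longlonglongrightarrow> v}"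

definition regular_normal_cone :: "'a::euclidean_space set \<Rightarrow> 'a \<Rightarrow> 'a set" where
  "regular_normal_cone C x = {v. \<forall>w\<in>tangent_cone C x. v \<bullet> w \<le> 0}"

definition proximal_normal_cone :: "'a::euclidean_space set \<Rightarrow> 'a \<Rightarrow> 'a set" where
  "proximal_normal_cone C x = {v. \<exists>a>0. x \<in> projection C (x + a *\<^sub>R v)}"

definition B_stationary :: "'a::euclidean_space set \<Rightarrow> ('a \<Rightarrow> real) \<Rightarrow> 'a \<Rightarrow> bool" where
  "B_stationary C f x \<longleftrightarrow> x \<in> C \<and> - grad f x \<in> regular_normal_cone C x"

definition P_stationary :: "'a::euclidean_space set \<Rightarrow> ('a \<Rightarrow> real) \<Rightarrow> 'a \<Rightarrow> bool" where
  "P_stationary C f x \<longleftrightarrow> x \<in> C \<and> - grad f x \<in> proximal_normal_cone C x"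

text \<open>\<open>pgd_trial C f \<alpha>min \<alpha>max \<beta> c x \<mu> \<alpha> y\<close>: some execution of the backtracking loop reaches the
  loop test with current step size \<open>\<alpha>\<close> and current candidate \<open>y\<close>.\<close>

inductive pgd_trial ::
    "'a::euclidean_space set \<Rightarrow> ('a \<Rightarrow> real) \<Rightarrow> real \<Rightarrow> real \<Rightarrow> real \<Rightarrow> real \<Rightarrow> 'a \<Rightarrow> real \<Rightarrow> real \<Rightarrow> 'a \<Rightarrow> bool"
  for C f \<alpha>min \<alpha>max \<beta> c x \<mu> where
  init: "\<lbrakk>\<alpha> \<in> {\<alpha>min..\<alpha>max}; y \<in> projection C (x - \<alpha> *\<^sub>R grad f x)\<rbrakk>
    \<Longrightarrow> pgd_trial C f \<alpha>min \<alpha>max \<beta> c x \<mu> \<alpha> y"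
| backtrack: "\<lbrakk>pgd_trial C f \<alpha>min \<alpha>max \<beta> c x \<mu> \<alpha> y;
     f y > \<mu> + c * (grad f x \<bullet> (y - x));
     y' \<in> projection C (x - (\<alpha> * \<beta>) *\<^sub>R grad f x)\<rbrakk>
    \<Longrightarrow> pgd_trial C f \<alpha>min \<alpha>max \<beta> c x \<mu> (\<alpha> * \<beta>) y'"

definition pgd_map ::
    "'a::euclidean_space set \<Rightarrow> ('a \<Rightarrow> real) \<Rightarrow> real \<Rightarrow> real \<Rightarrow> real \<Rightarrow> real \<Rightarrow> 'a \<Rightarrow> real \<Rightarrow> 'a set" where
  "pgd_map C f \<alpha>min \<alpha>max \<beta> c x \<mu> =
     {y. \<exists>\<alpha>. pgd_trial C f \<alpha>min \<alpha>max \<beta> c x \<mu> \<alpha> y \<and> \<not> (f y > \<mu> + c * (grad f x \<bullet> (y - x)))}"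

datatype pgd_rule = Max_Rule nat | Average_Rule real

fun valid_rule :: "pgd_rule \<Rightarrow> bool" where
  "valid_rule (Max_Rule l) \<longleftrightarrow> True"
| "valid_rule (Average_Rule p) \<longleftrightarrow> p \<in> {0<..1}"

text \<open>Below, \<open>F j\<close> stands for \<open>f (x\<^sub>j)\<close>. The index of \<open>average_level\<close> is shifted by one:
  \<open>average_level p F i\<close> is \<open>\<mu>\<^sub>i\<^sub>-\<^sub>1\<close>, starting from \<open>\<mu>\<^sub>-\<^sub>1 = f (x\<^sub>0)\<close>.\<close>

primrec average_level :: "real \<Rightarrow> (nat \<Rightarrow> real) \<Rightarrow> nat \<Rightarrow> real" where
  "average_level p F 0 = F 0"
| "average_level p F (Suc i) = (1 - p) * average_level p F i + p * F i"

text \<open>Truncated subtraction makes \<open>i - l\<close> equal to \<open>max {0, i - l}\<close>.\<close>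

fun pgd_level :: "pgd_rule \<Rightarrow> (nat \<Rightarrow> real) \<Rightarrow> nat \<Rightarrow> real" where
  "pgd_level (Max_Rule l) F i = Max (F ` {i - l..i})"
| "pgd_level (Average_Rule p) F i = average_level p F (Suc i)"

definition pgd_stop :: "'a::euclidean_space set \<Rightarrow> ('a \<Rightarrow> real) \<Rightarrow> 'a \<Rightarrow> bool" where
  "pgd_stop C f x \<longleftrightarrow>
     (if locally_lipschitz_gradient f then - grad f x \<in> proximal_normal_cone C x
      else - grad f x \<in> regular_normal_cone C x)"

text \<open>A generated sequence is represented by \<open>X\<close> together with \<open>N :: enat\<close>: for \<open>N = enat n\<close> it is
  the finite sequence \<open>X 0, \<dots>, X n\<close> (the other values of \<open>X\<close> are irrelevant), and for \<open>N = \<infinity>\<close> it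
  is the infinite sequence \<open>X\<close>.\<close>

definition pgd_sequence ::
    "'a::euclidean_space set \<Rightarrow> ('a \<Rightarrow> real) \<Rightarrow> real \<Rightarrow> real \<Rightarrow> real \<Rightarrow> real \<Rightarrow> pgd_rule \<Rightarrow>
     (nat \<Rightarrow> 'a) \<Rightarrow> enat \<Rightarrow> bool" where
  "pgd_sequence C f \<alpha>min \<alpha>max \<beta> c rule X N \<longleftrightarrow>
     X 0 \<in> C \<and>
     (\<forall>i. enat i < N \<longrightarrow>
        \<not> pgd_stop C f (X i) \<and>
        X (Suc i) \<in> pgd_map C f \<alpha>min \<alpha>max \<beta> c (X i) (pgd_level rule (\<lambda>j. f (X j)) i)) \<and>
     (\<forall>n. N = enat n \<longrightarrow> pgd_stop C f (X n))"

text \<open>Accumulation points of a sequence are limits of subsequences, not limit points of its range.\<close>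

definition accumulation_point :: "(nat \<Rightarrow> 'a::topological_space) \<Rightarrow> 'a \<Rightarrow> bool" where
  "accumulation_point X x \<longleftrightarrow> (\<exists>r :: nat \<Rightarrow> nat. strict_mono r \<and> (X \<circ> r) \<longlonglongrightarrow> x)"

end

theory Submission
  imports Defs
begin

text \<open>
  The finite case is the stopping test, together with the inclusion of the proximal normal cone in
  the regular normal cone. For an accumulation point \<open>x\<close> of an infinite sequence, the proof rests on
  two facts that pull against each other.

  \<^item> Near a point that is not B-stationary, accepted step sizes stay away from \<open>0\<close>
    (\<open>Armijo_near_nonstationary_point\<close> and \<open>pgd_trial_ge\<close>). Since \<open>f\<close> is differentiable only at the
    points of \<open>C\<close> and the difference quotients of \<open>f\<close> between two points near \<open>x\<close> are uncontrolled, a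
    Taylor expansion is available at \<open>x\<close> only. A tangent direction of descent at \<open>x\<close> provides
    feasible points at certain distances \<open>t\<^sub>i \<rightarrow> 0\<close>, possibly very sparse ones. Fix one sufficiently
    small \<open>t\<^sub>i\<close> and put \<open>\<tau> = M t\<^sub>i\<close>: every projected step from \<open>x\<close> with step size in \<open>[\<beta> \<tau>, \<tau>]\<close>
    satisfies the Armijo condition strictly, and by compactness the same holds, not strictly, from
    every point of \<open>C\<close> near \<open>x\<close>. Backtracking multiplies the step size by \<open>\<beta>\<close>, so it cannot jump
    over this window, and it stops inside it at the latest. If \<open>\<nabla>f\<close> is locally Lipschitz continuous,
    the descent lemma gives such a window around every point of \<open>C\<close>
    (\<open>Armijo_locally_lipschitz_gradient\<close>).

  \<^item> Along a subsequence converging to \<open>x\<close>, the gap \<open>\<mu>\<^sub>i - f (x\<^sub>i\<^sub>+\<^sub>1)\<close> between the acceptance level and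
    the accepted value tends to \<open>0\<close> (\<open>level_gap_subsequence\<close>). An accepted step satisfies
    \<open>\<parallel>x\<^sub>i\<^sub>+\<^sub>1 - x\<^sub>i\<parallel>\<^sup>2 \<le> K (\<mu>\<^sub>i - f (x\<^sub>i\<^sub>+\<^sub>1))\<close>, so the steps of the subsequence tend to \<open>0\<close> as well.

  If the step sizes \<open>\<alpha>\<close> of these vanishing steps are bounded away from \<open>0\<close>, then the relation
  \<open>x\<^sub>i\<^sub>+\<^sub>1 \<in> P\<^sub>C(x\<^sub>i - \<alpha> \<nabla>f(x\<^sub>i))\<close> passes to the limit, and \<open>x \<in> P\<^sub>C(x - a \<nabla>f(x))\<close> for some \<open>a > 0\<close>: the
  point is P-stationary (\<open>P_stationary_accumulation_point\<close>), hence B-stationary. So a point that is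
  not B-stationary cannot be an accumulation point, and with a locally Lipschitz gradient every
  accumulation point is P-stationary.
\<close>

section \<open>Projections\<close>

lemma projection_iff:
  "y \<in> projection C z \<longleftrightarrow> y \<in> C \<and> (\<forall>w\<in>C. norm (z - y) \<le> norm (z - w))"
  by (auto simp: projection_def is_arg_min_linorder)

text \<open>Comparing the distances from \<open>u - \<alpha> g\<close> to \<open>y\<close> and to a competitor \<open>z\<close>, with the squares expanded
  around \<open>u\<close>. The competitor \<open>z = u\<close> shows that a projected step is a descent step and bounds its
  length; competitors along a tangent direction bound the slope \<open>g \<bullet> (y - u)\<close> from above.\<close>

lemma projected_step_le:
  fixes g :: "'a::euclidean_space"
  assumes "y \<in> projection C (u - \<alpha> *\<^sub>R g)" and "z \<in> C"
  shows "(norm (y - u))\<^sup>2 + 2 * \<alpha> * (g \<bullet> (y - u)) \<le> (norm (z - u))\<^sup>2 + 2 * \<alpha> * (g \<bullet> (z - u))"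
proof -
  have expand: "(norm (u - \<alpha> *\<^sub>R g - w))\<^sup>2
      = (norm (w - u))\<^sup>2 + 2 * \<alpha> * (g \<bullet> (w - u)) + (norm (\<alpha> *\<^sub>R g))\<^sup>2" for w
    unfolding power2_norm_eq_inner
    by (simp add: inner_diff_left inner_diff_right inner_commute algebra_simps)
  have "norm (u - \<alpha> *\<^sub>R g - y) \<le> norm (u - \<alpha> *\<^sub>R g - z)"
    using assms by (auto simp: projection_iff)
  then have "(norm (u - \<alpha> *\<^sub>R g - y))\<^sup>2 \<le> (norm (u - \<alpha> *\<^sub>R g - z))\<^sup>2"
    by (simp add: power_mono)
  then show ?thesis
    unfolding expand by simp
qed

lemma projected_step_sq_le:
  fixes g :: "'a::euclidean_space"
  assumes "y \<in> projection C (u - \<alpha> *\<^sub>R g)" and "u \<in> C"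
  shows "(norm (y - u))\<^sup>2 \<le> 2 * \<alpha> * - (g \<bullet> (y - u))"
  using projected_step_le[OF assms] by simp

lemma projected_step_descent:
  fixes g :: "'a::euclidean_space"
  assumes "y \<in> projection C (u - \<alpha> *\<^sub>R g)" and "u \<in> C" and "0 < \<alpha>"
  shows "g \<bullet> (y - u) \<le> 0"
proof -
  have "0 \<le> 2 * \<alpha> * - (g \<bullet> (y - u))"
    using projected_step_sq_le[OF assms(1,2)] zero_le_power2 order_trans by blast
  then show ?thesis
    using assms(3) by (simp add: mult_le_0_iff)
qed

lemma projected_step_norm_le:
  fixes g :: "'a::euclidean_space"
  assumes "y \<in> projection C (u - \<alpha> *\<^sub>R g)" and "u \<in> C" and "0 \<le> \<alpha>"
  shows "norm (y - u) \<le> 2 * \<alpha> * norm g"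
proof (cases "y = u")
  case False
  have "- (g \<bullet> (y - u)) \<le> norm g * norm (y - u)"
    using norm_cauchy_schwarz[of "- g" "y - u"] by simp
  then have "2 * \<alpha> * - (g \<bullet> (y - u)) \<le> 2 * \<alpha> * (norm g * norm (y - u))"
    using assms(3) by (intro mult_left_mono) auto
  then have "norm (y - u) * norm (y - u) \<le> (2 * \<alpha> * norm g) * norm (y - u)"
    using projected_step_sq_le[OF assms(1,2)] by (simp add: power2_eq_square mult.assoc)
  then show ?thesis
    using False by (simp del: mult_minus_right)
qed (use assms in auto)

lemma projection_limit:
  assumes "closed C"
    and "\<And>n. y n \<in> projection C (z n)" and "z \<longlonglongrightarrow> z'" and "y \<longlonglongrightarrow> y'"
  shows "y' \<in> projection C z'"
proof -
  have "y' \<in> C"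
    using assms by (auto simp: projection_iff intro: closed_sequentially)
  moreover have "norm (z' - y') \<le> norm (z' - w)" if "w \<in> C" for w
  proof (rule LIMSEQ_le)
    show "(\<lambda>n. norm (z n - y n)) \<longlonglongrightarrow> norm (z' - y')"
      using assms(3,4) by (intro tendsto_intros)
    show "(\<lambda>n. norm (z n - w)) \<longlonglongrightarrow> norm (z' - w)"
      using assms(3) by (intro tendsto_intros)
    show "\<exists>N. \<forall>n\<ge>N. norm (z n - y n) \<le> norm (z n - w)"
      using assms(2) that by (auto simp: projection_iff)
  qed
  ultimately show ?thesis
    by (simp add: projection_iff)
qed

text \<open>The projections of a bounded sequence are bounded, because their distance to the projected point
  is at most that of any fixed point of \<open>C\<close>.\<close>

lemma projection_subsequential_limit:
  fixes C :: "'a::euclidean_space set"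
  assumes "closed C" and y: "\<And>n. y n \<in> projection C (z n)" and z: "z \<longlonglongrightarrow> z'"
  obtains r y' where "strict_mono (r :: nat \<Rightarrow> nat)" "(y \<circ> r) \<longlonglongrightarrow> y'" "y' \<in> projection C z'"
proof -
  obtain B where B: "\<And>n. norm (z n) \<le> B"
    using convergent_imp_Bseq[of z] z by (auto simp: convergent_def Bseq_def)
  have "norm (y n) \<le> B + (B + norm (y 0))" for n
  proof -
    have "norm (z n - y n) \<le> norm (z n - y 0)"
      using y by (auto simp: projection_iff)
    also have "\<dots> \<le> norm (z n) + norm (y 0)"
      by (rule norm_triangle_ineq4)
    finally show ?thesis
      using norm_triangle_sub[of "y n" "z n"] B[of n] by (simp add: norm_minus_commute)
  qed
  then have "bounded (range y)"
    by (auto simp: bounded_iff)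
  then obtain y' r where r: "strict_mono r" "(y \<circ> r) \<longlonglongrightarrow> y'"
    using bounded_imp_convergent_subsequence by blast
  have "y' \<in> projection C z'"
    by (rule projection_limit[OF assms(1) _ LIMSEQ_subseq_LIMSEQ[OF z r(1)] r(2)])
      (use y in \<open>auto simp: o_def\<close>)
  with r show thesis
    using that by blast
qed

section \<open>Stationarity\<close>

text \<open>If \<open>x\<close> is a nearest point of \<open>C\<close> to \<open>x + a v\<close>, then \<open>2 a \<langle>v, z - x\<rangle> \<le> \<parallel>z - x\<parallel>\<^sup>2\<close> for all \<open>z \<in> C\<close>.
  Dividing by \<open>t\<^sub>i\<close> along a sequence that defines a tangent vector makes the right side vanish.\<close>

lemma proximal_normal_cone_subset_regular:
  "proximal_normal_cone C x \<subseteq> regular_normal_cone C x"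
proof (rule subsetI, unfold regular_normal_cone_def, clarify)
  fix v w assume "v \<in> proximal_normal_cone C x" and "w \<in> tangent_cone C x"
  then obtain a Y t where a: "0 < a" "x \<in> projection C (x + a *\<^sub>R v)"
    and Y: "\<And>i. Y i \<in> C" "Y \<longlonglongrightarrow> x" and t: "\<And>i. 0 < t i"
    and w: "(\<lambda>i. (Y i - x) /\<^sub>R t i) \<longlonglongrightarrow> w"
    unfolding proximal_normal_cone_def tangent_cone_def by blast
  have "x \<in> C"
    using a(2) by (simp add: projection_iff)
  have "2 * a * (v \<bullet> ((Y i - x) /\<^sub>R t i)) \<le> norm (Y i - x) * norm ((Y i - x) /\<^sub>R t i)" for i
  proof -
    have "2 * a * (v \<bullet> (Y i - x)) \<le> (norm (Y i - x))\<^sup>2"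
      using projected_step_le[of x C x a "- v" "Y i"] a(2) Y(1) by simp
    then have "2 * a * (v \<bullet> (Y i - x)) / t i \<le> (norm (Y i - x))\<^sup>2 / t i"
      using t[of i] by (simp add: divide_right_mono)
    then show ?thesis
      using t[of i] by (simp add: divide_inverse_commute power2_eq_square mult.left_commute)
  qed
  moreover have "(\<lambda>i. 2 * a * (v \<bullet> ((Y i - x) /\<^sub>R t i))) \<longlonglongrightarrow> 2 * a * (v \<bullet> w)"
    using w by (intro tendsto_intros)
  moreover have "(\<lambda>i. norm (Y i - x) * norm ((Y i - x) /\<^sub>R t i)) \<longlonglongrightarrow> norm (x - x) * norm w"
    using w Y(2) by (intro tendsto_intros)
  ultimately have "2 * a * (v \<bullet> w) \<le> norm (x - x) * norm w"
    by (intro LIMSEQ_le) auto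
  then show "v \<bullet> w \<le> 0"
    using a(1) by (simp add: mult_le_0_iff)
qed

lemma P_stationary_imp_B_stationary: "P_stationary C f x \<Longrightarrow> B_stationary C f x"
  using proximal_normal_cone_subset_regular by (auto simp: P_stationary_def B_stationary_def)

lemma P_stationaryI:
  assumes "0 < a" and "x \<in> projection C (x - a *\<^sub>R grad f x)"
  shows "P_stationary C f x"
  using assms by (auto simp: P_stationary_def proximal_normal_cone_def projection_iff)

lemma has_derivative_grad:
  "GDERIV f x :> D \<Longrightarrow> (f has_derivative (\<lambda>h. h \<bullet> grad f x)) (at x)"
  using grad_eq by (fastforce simp: gderiv_def)

lemma continuously_differentiable_on_imp_continuous_on:
  "continuously_differentiable_on C f \<Longrightarrow> continuous_on C f"
  by (auto simp: continuously_differentiable_on_def intro!: continuous_at_imp_continuous_on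
      intro: has_derivative_continuous has_derivative_grad)

section \<open>Lower bounds on the step sizes of the backtracking loop\<close>

text \<open>Let \<open>w\<close> be a tangent vector with \<open>\<langle>\<nabla>f(x), w\<rangle> = -2 \<eta> < 0\<close>, approximated by points \<open>x + t\<^sub>i v\<^sub>i\<close> of \<open>C\<close>.
  Used as competitors in the projection, these points force the slope of the projected step to be at
  most \<open>- \<eta> t\<^sub>i / 2\<close> as long as the step size is comparable with \<open>t\<^sub>i\<close>. The step itself has length
  \<open>O(t\<^sub>i)\<close>, so the Taylor remainder \<open>o(t\<^sub>i)\<close> at \<open>x\<close> is negligible for large \<open>i\<close>. Nothing is known about the
  scales between the \<open>t\<^sub>i\<close>, which is why the conclusion only concerns a window of step sizes; its
  ratio \<open>\<beta>\<close> is the one that backtracking cannot jump over.\<close>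

lemma Armijo_at_nonstationary_point:
  assumes "x \<in> C" and "\<not> B_stationary C f x" and "GDERIV f x :> D"
    and "0 < \<beta>" and "c < 1" and "0 < \<alpha>0"
  obtains \<tau> where "0 < \<tau>" "\<tau> \<le> \<alpha>0"
    "\<And>\<alpha> y. \<lbrakk>\<alpha> \<in> {\<beta> * \<tau>..\<tau>}; y \<in> projection C (x - \<alpha> *\<^sub>R grad f x)\<rbrakk>
      \<Longrightarrow> f y < f x + c * (grad f x \<bullet> (y - x))"
proof -
  define g where "g = grad f x"
  obtain w where "w \<in> tangent_cone C x" and gw: "g \<bullet> w < 0"
    using assms(1,2) by (auto simp: B_stationary_def regular_normal_cone_def g_def not_le)
  then obtain Y t where Y: "\<And>i. Y i \<in> C" "Y \<longlonglongrightarrow> x" and t: "\<And>i. 0 < t i"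
    and w: "(\<lambda>i. (Y i - x) /\<^sub>R t i) \<longlonglongrightarrow> w"
    unfolding tangent_cone_def by blast
  define v where "v i = (Y i - x) /\<^sub>R t i" for i
  have Yv: "Y i - x = t i *\<^sub>R v i" for i
    using t[of i] by (simp add: v_def)
  have v: "v \<longlonglongrightarrow> w"
    using w by (simp add: v_def[abs_def])
  have "w \<noteq> 0"
    using gw by auto
  \<comment> \<open>The definition of the tangent cone does not ask for \<open>t\<^sub>i \<rightarrow> 0\<close>; it follows from \<open>w \<noteq> 0\<close>.\<close>
  have t0: "t \<longlonglongrightarrow> 0"
  proof -
    have "(\<lambda>i. norm (Y i - x) / norm (v i)) \<longlonglongrightarrow> norm (x - x) / norm w"
      using v Y(2) \<open>w \<noteq> 0\<close> by (intro tendsto_intros) auto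
    moreover have "\<forall>\<^sub>F i in sequentially. norm (Y i - x) / norm (v i) = t i"
      using tendsto_imp_eventually_ne[OF v \<open>w \<noteq> 0\<close>]
      by eventually_elim (use t in \<open>auto simp: Yv abs_of_pos\<close>)
    ultimately show ?thesis
      by (auto dest: Lim_transform_eventually)
  qed
  define \<eta> where "\<eta> = - (g \<bullet> w) / 2"
  have \<eta>: "0 < \<eta>"
    using gw by (simp add: \<eta>_def)
  define W where "W = (norm w)\<^sup>2 + 1"
  have W: "0 < W"
    by (simp add: W_def add_nonneg_pos)
  \<comment> \<open>With this \<open>M\<close>, the quadratic term \<open>t\<^sub>i\<^sup>2 \<parallel>v\<^sub>i\<parallel>\<^sup>2\<close> of the competitor is at most half of its linear
    gain \<open>2 \<alpha> t\<^sub>i \<eta>\<close> for every \<open>\<alpha> \<ge> \<beta> M t\<^sub>i\<close>.\<close>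
  define M where "M = W / (\<beta> * \<eta>)"
  have M: "0 < M"
    using W \<eta> assms(4) by (simp add: M_def)
  \<comment> \<open>The step has length at most \<open>2 M t\<^sub>i \<parallel>g\<parallel>\<close>, so the Taylor remainder is at most half of the
    margin \<open>(1 - c) t\<^sub>i \<eta> / 2\<close>; adding \<open>1\<close> to the denominator keeps it positive.\<close>
  define \<epsilon> where "\<epsilon> = (1 - c) * \<eta> / (4 * (2 * M * norm g + 1))"
  have den: "0 < 2 * M * norm g + 1"
    using M by (simp add: add_nonneg_pos)
  have \<epsilon>: "0 < \<epsilon>"
    using den assms(5) \<eta> by (simp add: \<epsilon>_def)
  obtain d where d: "0 < d"
    "\<And>y. norm (y - x) < d \<Longrightarrow> norm (f y - f x - (y - x) \<bullet> g) \<le> \<epsilon> * norm (y - x)"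
    using has_derivative_grad[OF assms(3)] \<epsilon>
    unfolding has_derivative_at_alt g_def by blast
  have "\<forall>\<^sub>F i in sequentially. g \<bullet> v i < - \<eta>"
    using gw by (intro order_tendstoD(2)[OF tendsto_inner[OF tendsto_const v]]) (simp add: \<eta>_def)
  moreover have "\<forall>\<^sub>F i in sequentially. (norm (v i))\<^sup>2 < W"
    by (intro order_tendstoD(2)[OF tendsto_power[OF tendsto_norm[OF v]]]) (simp add: W_def)
  moreover have "\<forall>\<^sub>F i in sequentially. M * t i < \<alpha>0"
    using tendsto_mult_left[OF t0, of M] assms(6) by (intro order_tendstoD(2)) auto
  moreover have "\<forall>\<^sub>F i in sequentially. 2 * (M * t i) * norm g < d"
  proof (rule order_tendstoD(2))
    show "(\<lambda>i. 2 * (M * t i) * norm g) \<longlonglongrightarrow> 2 * (M * 0) * norm g"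
      using t0 by (intro tendsto_intros)
  qed (use d in simp)
  ultimately have "\<forall>\<^sub>F i in sequentially. g \<bullet> v i < - \<eta> \<and> (norm (v i))\<^sup>2 < W \<and> M * t i < \<alpha>0
      \<and> 2 * (M * t i) * norm g < d"
    by eventually_elim auto
  then obtain i where i: "g \<bullet> v i < - \<eta>" "(norm (v i))\<^sup>2 < W" "M * t i < \<alpha>0"
      "2 * (M * t i) * norm g < d"
    using eventually_happens'[OF sequentially_bot] by blast
  have ti: "0 < t i"
    by (rule t)
  show thesis
  proof (rule that[of "M * t i"])
    fix \<alpha> y assume \<alpha>: "\<alpha> \<in> {\<beta> * (M * t i)..M * t i}" and y: "y \<in> projection C (x - \<alpha> *\<^sub>R grad f x)"
    have "0 < \<beta> * (M * t i)"
      using assms(4) M ti by simp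
    then have "0 < \<alpha>"
      using \<alpha> by auto
    have "norm (y - x) \<le> 2 * \<alpha> * norm g"
      using projected_step_norm_le[OF y assms(1)] \<open>0 < \<alpha>\<close> by (simp add: g_def)
    also have "\<dots> \<le> 2 * (M * t i) * norm g"
      using \<alpha> by (intro mult_right_mono) auto
    finally have ny: "norm (y - x) \<le> 2 * (M * t i) * norm g" .
    have "W * t i = \<beta> * (M * t i) * \<eta>"
      using \<eta> assms(4) by (simp add: M_def)
    also have "\<dots> \<le> \<alpha> * \<eta>"
      using \<alpha> \<eta> by (intro mult_right_mono) auto
    finally have Wt: "W * t i \<le> \<alpha> * \<eta>" .
    have "2 * \<alpha> * (g \<bullet> (y - x)) \<le> (norm (Y i - x))\<^sup>2 + 2 * \<alpha> * (g \<bullet> (Y i - x))"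
      using projected_step_le[OF y Y(1)[of i]] zero_le_power2[of "norm (y - x)"]
      unfolding g_def by linarith
    also have "\<dots> = t i * (t i * (norm (v i))\<^sup>2 + 2 * \<alpha> * (g \<bullet> v i))"
      by (simp add: Yv power2_eq_square algebra_simps)
    also have "\<dots> \<le> t i * (\<alpha> * \<eta> + 2 * \<alpha> * (- \<eta>))"
    proof (intro mult_left_mono add_mono)
      show "t i * (norm (v i))\<^sup>2 \<le> \<alpha> * \<eta>"
        using mult_left_mono[OF less_imp_le[OF i(2)] less_imp_le[OF ti]] Wt by (simp add: mult.commute[of W])
    qed (use \<open>0 < \<alpha>\<close> i ti in auto)
    also have "\<dots> = 2 * \<alpha> * (- (t i * \<eta> / 2))"
      by (simp add: algebra_simps)
    finally have gy: "g \<bullet> (y - x) \<le> - (t i * \<eta> / 2)"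
      by (rule mult_left_le_imp_le) (use \<open>0 < \<alpha>\<close> in simp)
    have "norm (f y - f x - (y - x) \<bullet> g) \<le> \<epsilon> * norm (y - x)"
      by (rule d(2)) (use ny i(4) in linarith)
    also have "\<dots> \<le> \<epsilon> * (2 * (M * t i) * norm g)"
      using \<epsilon> ny by (intro mult_left_mono) auto
    also have "\<dots> \<le> \<epsilon> * (2 * M * norm g + 1) * t i"
      using \<epsilon> ti by (simp add: algebra_simps)
    also have "\<epsilon> * (2 * M * norm g + 1) = (1 - c) * \<eta> / 4"
      using den unfolding \<epsilon>_def by (simp add: field_simps)
    finally have "\<bar>f y - f x - g \<bullet> (y - x)\<bar> \<le> (1 - c) * \<eta> / 4 * t i"
      by (simp add: inner_commute)
    then have "f y - f x - g \<bullet> (y - x) \<le> (1 - c) * \<eta> / 4 * t i"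
      by (rule order_trans[OF abs_ge_self])
    moreover have "(1 - c) * \<eta> / 4 * t i < (1 - c) * (t i * \<eta> / 2)"
      using assms(5) \<eta> ti by (simp add: field_simps)
    moreover have "(1 - c) * (g \<bullet> (y - x)) \<le> (1 - c) * (- (t i * \<eta> / 2))"
      using gy assms(5) by (intro mult_left_mono) auto
    ultimately have "f y - f x < g \<bullet> (y - x) - (1 - c) * (g \<bullet> (y - x))"
      by linarith
    then show "f y < f x + c * (grad f x \<bullet> (y - x))"
      by (simp add: g_def algebra_simps)
  qed (use M ti i(3) in simp_all)
qed

text \<open>The strict inequality at \<open>x\<close> spreads to a neighbourhood, as a weak one, because the window of step
  sizes is compact and projections have closed graph: failures at points tending to \<open>x\<close> would
  accumulate at a projected step from \<open>x\<close> that violates the strict inequality.\<close>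

lemma Armijo_near_nonstationary_point:
  fixes f :: "'a::euclidean_space \<Rightarrow> real"
  assumes "closed C" and cd: "continuously_differentiable_on C f"
    and "x \<in> C" and "\<not> B_stationary C f x"
    and "0 < \<beta>" and "c < 1" and "0 < \<alpha>0"
  obtains \<tau> r where "0 < \<tau>" "\<tau> \<le> \<alpha>0" "0 < r"
    "\<And>u \<alpha> y. \<lbrakk>u \<in> C; dist u x < r; \<alpha> \<in> {\<beta> * \<tau>..\<tau>}; y \<in> projection C (u - \<alpha> *\<^sub>R grad f u)\<rbrakk>
      \<Longrightarrow> f y \<le> f u + c * (grad f u \<bullet> (y - u))"
proof -
  obtain D where D: "GDERIV f x :> D"
    using cd assms(3) by (auto simp: continuously_differentiable_on_def)
  have contf: "continuous_on C f"
    using cd by (rule continuously_differentiable_on_imp_continuous_on)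
  have contg: "continuous_on C (grad f)"
    using cd by (simp add: continuously_differentiable_on_def)
  obtain \<tau> where \<tau>: "0 < \<tau>" "\<tau> \<le> \<alpha>0"
    "\<And>\<alpha> y. \<lbrakk>\<alpha> \<in> {\<beta> * \<tau>..\<tau>}; y \<in> projection C (x - \<alpha> *\<^sub>R grad f x)\<rbrakk>
      \<Longrightarrow> f y < f x + c * (grad f x \<bullet> (y - x))"
    by (rule Armijo_at_nonstationary_point[OF assms(3,4) D assms(5-7)]) (rule that)
  define good where "good r \<longleftrightarrow> (\<forall>u \<alpha> y. u \<in> C \<longrightarrow> dist u x < r \<longrightarrow> \<alpha> \<in> {\<beta> * \<tau>..\<tau>} \<longrightarrow>
      y \<in> projection C (u - \<alpha> *\<^sub>R grad f u) \<longrightarrow> f y \<le> f u + c * (grad f u \<bullet> (y - u)))" for r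
  have "\<exists>r>0. good r"
  proof (rule ccontr)
    assume contra: "\<not> (\<exists>r>0. good r)"
    have "\<forall>n. \<exists>u \<alpha> y. u \<in> C \<and> dist u x < inverse (real (Suc n)) \<and> \<alpha> \<in> {\<beta> * \<tau>..\<tau>} \<and>
        y \<in> projection C (u - \<alpha> *\<^sub>R grad f u) \<and> f u + c * (grad f u \<bullet> (y - u)) < f y"
    proof
      fix n
      have "\<not> good (inverse (real (Suc n)))"
        using contra by simp
      then show "\<exists>u \<alpha> y. u \<in> C \<and> dist u x < inverse (real (Suc n)) \<and> \<alpha> \<in> {\<beta> * \<tau>..\<tau>} \<and>
        y \<in> projection C (u - \<alpha> *\<^sub>R grad f u) \<and> f u + c * (grad f u \<bullet> (y - u)) < f y"
        by (simp only: good_def not_all not_imp not_le)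
    qed
    then obtain u \<alpha> y where uC: "\<And>n. u n \<in> C" and ux: "\<And>n. dist (u n) x < inverse (real (Suc n))"
      and \<alpha>: "\<And>n. \<alpha> n \<in> {\<beta> * \<tau>..\<tau>}" and y: "\<And>n. y n \<in> projection C (u n - \<alpha> n *\<^sub>R grad f (u n))"
      and fails: "\<And>n. f (u n) + c * (grad f (u n) \<bullet> (y n - u n)) < f (y n)"
      by metis
    have u: "u \<longlonglongrightarrow> x"
      unfolding tendsto_dist_iff[of u]
      by (rule Lim_null_comparison[OF _ LIMSEQ_inverse_real_of_nat])
        (use ux in \<open>auto intro!: always_eventually less_imp_le\<close>)
    have "compact {\<beta> * \<tau>..\<tau>}"
      by simp
    then obtain r \<alpha>' where \<alpha>': "\<alpha>' \<in> {\<beta> * \<tau>..\<tau>}" and r: "strict_mono r" "(\<alpha> \<circ> r) \<longlonglongrightarrow> \<alpha>'"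
      using \<alpha> unfolding compact_def by metis
    have ur: "(u \<circ> r) \<longlonglongrightarrow> x"
      by (rule LIMSEQ_subseq_LIMSEQ[OF u r(1)])
    have gr: "(\<lambda>n. grad f ((u \<circ> r) n)) \<longlonglongrightarrow> grad f x"
      using continuous_on_tendsto_compose[OF contg ur assms(3)] uC by simp
    have zr: "(\<lambda>n. (u \<circ> r) n - (\<alpha> \<circ> r) n *\<^sub>R grad f ((u \<circ> r) n)) \<longlonglongrightarrow> x - \<alpha>' *\<^sub>R grad f x"
      by (intro tendsto_intros ur r(2) gr)
    obtain s y' where s: "strict_mono s" "((y \<circ> r) \<circ> s) \<longlonglongrightarrow> y'"
      and y': "y' \<in> projection C (x - \<alpha>' *\<^sub>R grad f x)"
      by (rule projection_subsequential_limit[OF assms(1) _ zr, of "y \<circ> r"]) (use y in auto)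
    have us: "((u \<circ> r) \<circ> s) \<longlonglongrightarrow> x"
      by (rule LIMSEQ_subseq_LIMSEQ[OF ur s(1)])
    have gs: "(\<lambda>n. grad f (((u \<circ> r) \<circ> s) n)) \<longlonglongrightarrow> grad f x"
      using continuous_on_tendsto_compose[OF contg us assms(3)] uC by simp
    have "f x + c * (grad f x \<bullet> (y' - x)) \<le> f y'"
    proof (rule LIMSEQ_le)
      show "(\<lambda>n. f (((u \<circ> r) \<circ> s) n) + c * (grad f (((u \<circ> r) \<circ> s) n) \<bullet>
          (((y \<circ> r) \<circ> s) n - ((u \<circ> r) \<circ> s) n))) \<longlonglongrightarrow> f x + c * (grad f x \<bullet> (y' - x))"
        using continuous_on_tendsto_compose[OF contf us assms(3)] uC
        by (intro tendsto_intros gs us s(2)) simp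
      show "(\<lambda>n. f (((y \<circ> r) \<circ> s) n)) \<longlonglongrightarrow> f y'"
        using continuous_on_tendsto_compose[OF contf s(2)] y y' by (simp add: projection_iff)
    qed (use fails in \<open>auto intro!: exI less_imp_le\<close>)
    with \<tau>(3)[OF \<alpha>' y'] show False
      by simp
  qed
  then obtain r where r: "0 < r" "good r"
    by blast
  show thesis
    by (rule that[OF \<tau>(1,2) r(1)]) (rule r(2)[unfolded good_def, rule_format])
qed

text \<open>The mean value inequality on the segment, with \<open>L\<close> in place of the optimal constant \<open>L/2\<close>.\<close>

lemma descent_lemma:
  fixes f :: "'a::euclidean_space \<Rightarrow> real"
  assumes "\<And>z. z \<in> S \<Longrightarrow> \<exists>D. GDERIV f z :> D" and L: "L-lipschitz_on S (grad f)"
    and "convex S" and "u \<in> S" and "y \<in> S"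
  shows "f y \<le> f u + grad f u \<bullet> (y - u) + L * (norm (y - u))\<^sup>2"
proof -
  have sub: "closed_segment u y \<subseteq> S"
    using assms(3-5) by (simp add: closed_segment_subset)
  have "norm (f y - f u - (y - u) \<bullet> grad f u) \<le> norm (y - u) * (L * norm (y - u))"
  proof (rule differentiable_bound_linearization[of u y "closed_segment u y" f "\<lambda>(z::'a) (h::'a). h \<bullet> grad f z" u])
    show "u + t *\<^sub>R (y - u) \<in> closed_segment u y" if "t \<in> {0..1}" for t
      using that by (auto simp: in_segment algebra_simps intro!: exI[of _ t])
    fix z assume z: "z \<in> closed_segment u y"
    then have "z \<in> S"
      using sub by blast
    show "(f has_derivative (\<lambda>h. h \<bullet> grad f z)) (at z within closed_segment u y)"
      using assms(1)[OF \<open>z \<in> S\<close>] has_derivative_grad has_derivative_at_withinI by blast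
    show "onorm ((\<lambda>h. h \<bullet> grad f z) - (\<lambda>h. h \<bullet> grad f u)) \<le> L * norm (y - u)"
    proof (rule onorm_le)
      fix h :: 'a
      have "norm (grad f z - grad f u) \<le> L * norm (z - u)"
        using lipschitz_onD[OF L \<open>z \<in> S\<close> assms(4)] by (simp add: dist_norm)
      also have "\<dots> \<le> L * norm (y - u)"
        using segment_bound(1)[OF z] lipschitz_on_nonneg[OF L] by (intro mult_left_mono) auto
      finally have "norm h * norm (grad f z - grad f u) \<le> norm h * (L * norm (y - u))"
        by (intro mult_left_mono) auto
      moreover have "norm (h \<bullet> (grad f z - grad f u)) \<le> norm h * norm (grad f z - grad f u)"
        by (simp add: Cauchy_Schwarz_ineq2)
      ultimately show "norm (((\<lambda>h. h \<bullet> grad f z) - (\<lambda>h. h \<bullet> grad f u)) h) \<le> L * norm (y - u) * norm h"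
        by (simp add: inner_diff_right mult.commute)
    qed
  qed simp
  then show ?thesis
    by (simp add: inner_commute power2_eq_square abs_le_iff algebra_simps)
qed

text \<open>With \<open>s = - \<langle>\<nabla>f(u), y - u\<rangle>\<close>, the descent lemma and \<open>\<parallel>y - u\<parallel>\<^sup>2 \<le> 2 \<alpha> s\<close> give
  \<open>f(y) \<le> f(u) - s + 2 L \<alpha> s\<close>, and \<open>2 L \<alpha> \<le> 1 - c\<close> for small \<open>\<alpha>\<close>.\<close>

lemma Armijo_locally_lipschitz_gradient:
  fixes f :: "'a::euclidean_space \<Rightarrow> real"
  assumes LL: "locally_lipschitz_gradient f" and cont: "continuous_on C (grad f)"
    and "x \<in> C" and "c < 1" and "0 < \<alpha>0"
  obtains \<tau> r where "0 < \<tau>" "\<tau> \<le> \<alpha>0" "0 < r"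
    "\<And>u \<alpha> y. \<lbrakk>u \<in> C; dist u x < r; \<alpha> \<in> {0<..\<tau>}; y \<in> projection C (u - \<alpha> *\<^sub>R grad f u)\<rbrakk>
      \<Longrightarrow> f y \<le> f u + c * (grad f u \<bullet> (y - u))"
proof -
  have GD: "\<And>z. \<exists>D. GDERIV f z :> D"
    using LL by (simp add: locally_lipschitz_gradient_def)
  obtain \<rho> L where \<rho>: "0 < \<rho>" and L: "L-lipschitz_on (ball x \<rho>) (grad f)"
    using LL unfolding locally_lipschitz_gradient_def by blast
  have "0 \<le> L"
    using L by (rule lipschitz_on_nonneg)
  define G where "G = norm (grad f x) + 1"
  have "0 < G"
    by (simp add: G_def add_nonneg_pos)
  obtain r1 where r1: "0 < r1" "\<And>u. \<lbrakk>u \<in> C; dist u x < r1\<rbrakk> \<Longrightarrow> dist (grad f u) (grad f x) < 1"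
    using cont assms(3) unfolding continuous_on_iff by (meson zero_less_one)
  have G: "norm (grad f u) \<le> G" if "u \<in> C" "dist u x < r1" for u
    using r1(2)[OF that] norm_triangle_sub[of "grad f u" "grad f x"] by (simp add: G_def dist_norm)
  \<comment> \<open>The second bound keeps the projected point in \<open>ball x \<rho>\<close>; the third makes \<open>2 L \<alpha> \<le> 1 - c\<close>, also
    for \<open>L = 0\<close>.\<close>
  define \<tau> where "\<tau> = min \<alpha>0 (min (\<rho> / (4 * G)) ((1 - c) / (2 * (L + 1))))"
  show thesis
  proof (rule that[of \<tau> "min r1 (\<rho> / 2)"])
    show "0 < \<tau>"
      using assms(4,5) \<rho> \<open>0 < G\<close> \<open>0 \<le> L\<close> by (simp add: \<tau>_def)
    fix u \<alpha> y
    assume u: "u \<in> C" "dist u x < min r1 (\<rho> / 2)" and \<alpha>: "\<alpha> \<in> {0<..\<tau>}"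
      and y: "y \<in> projection C (u - \<alpha> *\<^sub>R grad f u)"
    define s where "s = - (grad f u \<bullet> (y - u))"
    have "0 \<le> s"
      using projected_step_descent[OF y u(1)] \<alpha> by (simp add: s_def)
    have "norm (y - u) \<le> 2 * \<alpha> * norm (grad f u)"
      using projected_step_norm_le[OF y u(1)] \<alpha> by simp
    also have "\<dots> \<le> 2 * (\<rho> / (4 * G)) * G"
      using \<alpha> G[of u] u \<rho> \<open>0 < G\<close> by (intro mult_mono) (auto simp: \<tau>_def)
    also have "\<dots> = \<rho> / 2"
      using \<open>0 < G\<close> by simp
    finally have "dist y x < \<rho>"
      using dist_triangle[of y x u] u(2) by (simp add: dist_norm)
    then have "f y \<le> f u + grad f u \<bullet> (y - u) + L * (norm (y - u))\<^sup>2"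
      using u(2) \<rho> by (intro descent_lemma[OF GD L]) (auto simp: dist_commute)
    also have "L * (norm (y - u))\<^sup>2 \<le> L * (2 * \<alpha> * s)"
      using projected_step_sq_le[OF y u(1)] \<open>0 \<le> L\<close> by (intro mult_left_mono) (auto simp: s_def)
    also have "L * (2 * \<alpha> * s) = (2 * L * \<alpha>) * s"
      by simp
    also have "\<dots> \<le> (1 - c) * s"
    proof (rule mult_right_mono[OF _ \<open>0 \<le> s\<close>])
      have "2 * L * \<alpha> \<le> 2 * (L + 1) * ((1 - c) / (2 * (L + 1)))"
        using \<alpha> \<open>0 \<le> L\<close> by (intro mult_mono) (auto simp: \<tau>_def)
      then show "2 * L * \<alpha> \<le> 1 - c"
        using \<open>0 \<le> L\<close> by simp
    qed
    finally show "f y \<le> f u + c * (grad f u \<bullet> (y - u))"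
      by (simp add: s_def algebra_simps)
  qed (use r1 \<rho> in \<open>auto simp: \<tau>_def\<close>)
qed

text \<open>A rejected step size that is at least \<open>\<beta> \<tau>\<close> lies above the window \<open>[\<beta> \<tau>, \<tau>]\<close>, so its product with
  \<open>\<beta>\<close> is still at least \<open>\<beta> \<tau>\<close>.\<close>

lemma pgd_trial_ge:
  assumes "pgd_trial C f \<alpha>min \<alpha>max \<beta> c u \<mu> \<alpha> y"
    and "0 < \<beta>" and "\<beta> < 1" and "0 < \<tau>" and "\<tau> \<le> \<alpha>min" and "f u \<le> \<mu>"
    and Armijo: "\<And>\<alpha> y. \<lbrakk>\<alpha> \<in> {\<beta> * \<tau>..\<tau>}; y \<in> projection C (u - \<alpha> *\<^sub>R grad f u)\<rbrakk>
      \<Longrightarrow> f y \<le> f u + c * (grad f u \<bullet> (y - u))"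
  shows "\<beta> * \<tau> \<le> \<alpha>"
proof -
  have "\<beta> * \<tau> \<le> \<alpha> \<and> y \<in> projection C (u - \<alpha> *\<^sub>R grad f u)"
    using assms(1)
  proof induction
    case (init \<alpha> y)
    have "\<beta> * \<tau> \<le> \<tau>"
      using assms(3,4) by simp
    with init assms(5) show ?case
      by auto
  next
    case (backtrack \<alpha> y y')
    have "\<tau> < \<alpha>"
      using backtrack Armijo[of \<alpha> y] assms(6) by force
    then show ?case
      using assms(2) backtrack by (simp add: mult.commute)
  qed
  then show ?thesis ..
qed

lemma pgd_trial_projection:
  "pgd_trial C f \<alpha>min \<alpha>max \<beta> c u \<mu> \<alpha> y \<Longrightarrow> y \<in> projection C (u - \<alpha> *\<^sub>R grad f u)"
  by (auto elim: pgd_trial.cases)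

lemma pgd_trial_step_bounds:
  assumes "pgd_trial C f \<alpha>min \<alpha>max \<beta> c u \<mu> \<alpha> y" and "0 < \<alpha>min" and "0 < \<beta>" and "\<beta> < 1"
  shows "\<alpha> \<in> {0<..\<alpha>max}"
  using assms(1)
proof induction
  case (backtrack \<alpha> y y')
  then have "\<alpha> * \<beta> \<le> \<alpha>"
    using assms(4) by (simp add: mult_left_le)
  also have "\<alpha> \<le> \<alpha>max"
    using backtrack by simp
  finally show ?case
    using backtrack assms(3) by simp
qed (use assms(2) in auto)

section \<open>The acceptance levels\<close>

lemma average_level_bounds:
  assumes "p \<in> {0<..1}" and "\<And>i. F (Suc i) \<le> average_level p F (Suc i)"
  shows "F i \<le> average_level p F (Suc i)"
    and "average_level p F (Suc i) \<le> average_level p F i"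
proof -
  have "F i \<le> average_level p F i"
    using assms(2) by (cases i) auto
  then have "0 \<le> (1 - p) * (average_level p F i - F i)" "0 \<le> p * (average_level p F i - F i)"
    using assms(1) by auto
  then show "F i \<le> average_level p F (Suc i)" "average_level p F (Suc i) \<le> average_level p F i"
    by (simp_all add: algebra_simps)
qed

lemma pgd_level_ge:
  assumes "valid_rule rule" and "\<And>i. F (Suc i) \<le> pgd_level rule F i"
  shows "F i \<le> pgd_level rule F i"
proof (cases rule)
  case (Average_Rule p)
  then show ?thesis
    using average_level_bounds(1)[of p F i] assms by simp
qed simp

lemma decseq_pgd_level:
  assumes "valid_rule rule" and "\<And>i. F (Suc i) \<le> pgd_level rule F i"
  shows "decseq (pgd_level rule F)"
proof (rule decseq_SucI)
  fix i
  show "pgd_level rule F (Suc i) \<le> pgd_level rule F i"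
  proof (cases rule)
    case (Max_Rule l)
    have "F j \<le> Max (F ` {i - l..i})" if "j \<in> {Suc i - l..Suc i}" for j
      using that assms(2)[of i] Max_Rule by (cases "j = Suc i") auto
    with Max_Rule show ?thesis
      by simp
  next
    case (Average_Rule p)
    then show ?thesis
      using average_level_bounds(2)[of p F "Suc i"] assms by simp
  qed
qed

text \<open>The gap is \<open>(\<mu>\<^sub>i - \<mu>\<^sub>i\<^sub>+\<^sub>1) / p\<close>, a difference of consecutive terms of a convergent sequence.\<close>

lemma average_level_gap_tendsto_0:
  assumes "p \<in> {0<..1}" and "(\<lambda>i. average_level p F (Suc i)) \<longlonglongrightarrow> m"
  shows "(\<lambda>i. average_level p F (Suc i) - F (Suc i)) \<longlonglongrightarrow> 0"
proof -
  have "(\<lambda>i. average_level p F (Suc (Suc i))) \<longlonglongrightarrow> m"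
    using assms(2) by (rule LIMSEQ_Suc)
  with assms have "(\<lambda>i. (average_level p F (Suc i) - average_level p F (Suc (Suc i))) / p) \<longlonglongrightarrow> (m - m) / p"
    by (intro tendsto_intros) auto
  moreover have "(average_level p F (Suc i) - average_level p F (Suc (Suc i))) / p
      = average_level p F (Suc i) - F (Suc i)" for i
    using assms(1) by (simp add: field_simps)
  ultimately show ?thesis
    by simp
qed

text \<open>The sequence as a whole may be unbounded, but the length of a step is controlled by a continuous
  function of its starting point. So boundedness along a subsequence is inherited by the terms a
  fixed number of steps later.\<close>

lemma bounded_shifted_subsequence:
  fixes X :: "nat \<Rightarrow> 'a::heine_borel" and g :: "'a \<Rightarrow> 'b::metric_space"
  assumes "closed C" and "continuous_on C g" and X: "\<And>i. X i \<in> C"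
    and step: "\<And>i. dist (X (Suc i)) (X i) \<le> B * dist (g (X i)) a" and "0 \<le> B"
    and "bounded (range (\<lambda>k. X (r k)))"
  shows "bounded (range (\<lambda>k. X (r k + m)))"
proof (induction m)
  case (Suc m)
  define K where "K = closure (range (\<lambda>k. X (r k + m)))"
  have "compact K"
    using Suc by (simp add: K_def compact_closure)
  moreover have "K \<subseteq> C"
    using assms(1) X unfolding K_def by (intro closure_minimal) auto
  ultimately have "bounded (g ` K)"
    using assms(2) by (intro compact_imp_bounded compact_continuous_image) (auto intro: continuous_on_subset)
  then obtain G where "\<forall>y\<in>g ` K. dist a y \<le> G"
    using bounded_any_center[of "g ` K" a] by auto
  then have G: "dist (g (X (r k + m))) a \<le> G" for k
    using closure_subset[of "range (\<lambda>k. X (r k + m))"] unfolding K_def by (auto simp: dist_commute)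
  obtain z e where e: "\<And>k. dist z (X (r k + m)) \<le> e"
    using Suc unfolding bounded_def by auto
  have "dist z (X (r k + Suc m)) \<le> e + B * G" for k
  proof -
    have "dist (X (Suc (r k + m))) (X (r k + m)) \<le> B * G"
      using step[of "r k + m"] mult_left_mono[OF G[of k] assms(5)] by linarith
    then show ?thesis
      using dist_triangle[of z "X (Suc (r k + m))" "X (r k + m)"] e[of k]
      by (simp add: dist_commute)
  qed
  then show ?case
    unfolding bounded_def by auto
qed (use assms(6) in simp)

text \<open>Going back in time from a delay \<open>j\<close> at which the values tend to the limit \<open>m\<close> of the levels: the gap
  of the step leading there tends to \<open>0\<close>, hence so does its length, and uniform continuity of \<open>f\<close> on
  a compact set carries the limit \<open>m\<close> over to the starting point of that step.\<close>

lemma level_gap_tendsto_0_of_later: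
  fixes X :: "nat \<Rightarrow> 'a::euclidean_space" and f :: "'a \<Rightarrow> real"
  assumes "closed C" and contf: "continuous_on C f" and X: "\<And>i. X i \<in> C"
    and bdd: "\<And>m. bounded (range (\<lambda>k. X (r k + m)))"
    and gap: "\<And>i. (norm (X (Suc i) - X i))\<^sup>2 \<le> K * (\<mu> i - f (X (Suc i)))"
    and \<mu>: "\<mu> \<longlonglongrightarrow> m" and r: "strict_mono r"
    and "(\<lambda>k. f (X (Suc (r k + j)))) \<longlonglongrightarrow> m"
  shows "(\<lambda>k. \<mu> (r k) - f (X (Suc (r k)))) \<longlonglongrightarrow> 0"
  using assms(8)
proof (induction j)
  have \<mu>r: "(\<lambda>k. \<mu> (r k + i)) \<longlonglongrightarrow> m" for i
  proof -
    have "strict_mono (\<lambda>k. r k + i)"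
      using r by (simp add: strict_mono_def)
    then show ?thesis
      using LIMSEQ_subseq_LIMSEQ[OF \<mu>] by (simp add: o_def)
  qed
  {
    case 0
    then show ?case
      using tendsto_diff[OF \<mu>r[of 0]] by fastforce
  next
    case (Suc j)
    define Y where "Y i k = X (r k + i)" for i k
    have lim: "(\<lambda>k. f (Y (Suc (Suc j)) k)) \<longlonglongrightarrow> m"
      using Suc.prems by (simp add: Y_def)
    have "(\<lambda>k. K * (\<mu> (r k + Suc j) - f (Y (Suc (Suc j)) k))) \<longlonglongrightarrow> K * (m - m)"
      by (intro tendsto_intros \<mu>r lim)
    then have "(\<lambda>k. K * (\<mu> (r k + Suc j) - f (Y (Suc (Suc j)) k))) \<longlonglongrightarrow> 0"
      by simp
    then have "(\<lambda>k. (norm (Y (Suc (Suc j)) k - Y (Suc j) k))\<^sup>2) \<longlonglongrightarrow> 0"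
      by (rule Lim_null_comparison[rotated]) (use gap in \<open>simp add: Y_def\<close>)
    then have near: "(\<lambda>k. dist (Y (Suc (Suc j)) k) (Y (Suc j) k)) \<longlonglongrightarrow> 0"
      using tendsto_real_sqrt by (fastforce simp: dist_norm)
    define S where "S = closure (range (Y (Suc j)) \<union> range (Y (Suc (Suc j))))"
    have "compact S"
      unfolding S_def compact_closure bounded_Un Y_def using bdd by blast
    moreover have "S \<subseteq> C"
      unfolding S_def by (rule closure_minimal) (use X assms(1) in \<open>auto simp: Y_def\<close>)
    ultimately have "uniformly_continuous_on S f"
      using contf by (intro compact_uniformly_continuous) (auto intro: continuous_on_subset)
    moreover have "Y (Suc j) k \<in> S" "Y (Suc (Suc j)) k \<in> S" for k
      unfolding S_def by (rule subsetD[OF closure_subset]; simp)+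
    ultimately have "(\<lambda>k. dist (f (Y (Suc (Suc j)) k)) (f (Y (Suc j) k))) \<longlonglongrightarrow> 0"
      using near unfolding uniformly_continuous_on_sequentially by blast
    then have "(\<lambda>k. f (Y (Suc (Suc j)) k) - f (Y (Suc j) k)) \<longlonglongrightarrow> 0"
      by (simp add: dist_norm tendsto_rabs_zero_iff)
    from tendsto_diff[OF lim this] show ?case
      by (intro Suc.IH) (simp add: Y_def)
  }
qed

text \<open>The level with index \<open>r k + 1 + l\<close> is the value at one of the \<open>l + 1\<close> indices
  \<open>r k + 1, \<dots>, r k + 1 + l\<close>; by the pigeonhole principle the same delay occurs infinitely often.\<close>

lemma max_level_attained_at_fixed_delay:
  assumes "(\<lambda>i. pgd_level (Max_Rule l) F i) \<longlonglongrightarrow> m" and "strict_mono (r :: nat \<Rightarrow> nat)"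
  obtains s j where "strict_mono s" "(\<lambda>k. F (Suc (r (s k) + j))) \<longlonglongrightarrow> m"
proof -
  have "\<exists>j\<in>{..l}. F (Suc (r k + j)) = pgd_level (Max_Rule l) F (Suc (r k + l))" for k
  proof -
    have "Max (F ` {Suc (r k)..Suc (r k + l)}) \<in> F ` {Suc (r k)..Suc (r k + l)}"
      by (intro Max_in) auto
    then obtain i where i: "i \<in> {Suc (r k)..Suc (r k + l)}"
      "F i = Max (F ` {Suc (r k)..Suc (r k + l)})"
      by force
    then show ?thesis
      by (intro bexI[of _ "i - Suc (r k)"]) auto
  qed
  then obtain J where J: "\<And>k. J k \<in> {..l}"
    "\<And>k. F (Suc (r k + J k)) = pgd_level (Max_Rule l) F (Suc (r k + l))"
    by metis
  have "finite (J ` UNIV)"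
    by (rule finite_subset[of _ "{..l}"]) (use J(1) in auto)
  then obtain k0 where "infinite {k. J k = J k0}"
    using pigeonhole_infinite[of UNIV J] by auto
  then obtain s :: "nat \<Rightarrow> nat" where s: "strict_mono s" "\<forall>k. J (s k) = J k0"
    using infinite_enumerate[of "{k. J k = J k0}"] by auto
  have "strict_mono (\<lambda>k. Suc (r (s k) + l))"
    using assms(2) s(1) by (simp add: strict_mono_def)
  from LIMSEQ_subseq_LIMSEQ[OF assms(1) this]
  have "(\<lambda>k. pgd_level (Max_Rule l) F (Suc (r (s k) + l))) \<longlonglongrightarrow> m"
    by (simp add: o_def)
  then have "(\<lambda>k. F (Suc (r (s k) + J k0))) \<longlonglongrightarrow> m"
    using J(2)[of "s k" for k] s(2) by simp
  with s(1) show thesis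
    by (rule that)
qed

text \<open>The levels decrease, and they are bounded below because \<open>f\<close> converges along \<open>r\<close>; so they converge.
  For the average rule all gaps then tend to \<open>0\<close>. For the max rule an iterate at most \<open>l + 1\<close> steps
  later attains the level, and one goes back from there.\<close>

lemma level_gap_subsequence:
  fixes X :: "nat \<Rightarrow> 'a::euclidean_space" and f :: "'a \<Rightarrow> real"
  assumes "closed C" and contf: "continuous_on C f" and contg: "continuous_on C g" and X: "\<And>i. X i \<in> C"
    and "valid_rule rule"
    and step: "\<And>i. norm (X (Suc i) - X i) \<le> B * norm (g (X i))" and "0 \<le> B"
    and desc: "\<And>i. f (X (Suc i)) \<le> pgd_level rule (\<lambda>j. f (X j)) i"
    and gap: "\<And>i. (norm (X (Suc i) - X i))\<^sup>2 \<le> K * (pgd_level rule (\<lambda>j. f (X j)) i - f (X (Suc i)))"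
    and r: "strict_mono r" "(\<lambda>k. X (r k)) \<longlonglongrightarrow> x"
  obtains s where "strict_mono s"
    "(\<lambda>k. pgd_level rule (\<lambda>j. f (X j)) (r (s k)) - f (X (Suc (r (s k))))) \<longlonglongrightarrow> 0"
proof -
  define F where "F j = f (X j)" for j
  define \<mu> where "\<mu> = pgd_level rule F"
  have F: "(\<lambda>j. f (X j)) = F"
    by (simp add: F_def fun_eq_iff)
  have F_desc: "F (Suc i) \<le> pgd_level rule F i" for i
    using desc[of i] unfolding F by (simp add: F_def)
  have ge: "F i \<le> \<mu> i" for i
    unfolding \<mu>_def by (rule pgd_level_ge[OF assms(5) F_desc])
  have gap': "(norm (X (Suc i) - X i))\<^sup>2 \<le> K * (\<mu> i - f (X (Suc i)))" for i
    using gap[of i] by (simp add: \<mu>_def F)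
  have dec: "decseq \<mu>"
    unfolding \<mu>_def by (rule decseq_pgd_level[OF assms(5) F_desc])
  have "x \<in> C"
    using closed_sequentially[OF assms(1) _ r(2)] X by simp
  have "(\<lambda>k. F (r k)) \<longlonglongrightarrow> f x"
    unfolding F_def using continuous_on_tendsto_compose[OF contf r(2) \<open>x \<in> C\<close>] X by simp
  then have "Bseq (\<lambda>k. F (r k))"
    by (intro convergent_imp_Bseq convergentI)
  then obtain B' where "\<And>k. norm (F (r k)) \<le> B'"
    by (auto simp: Bseq_def)
  then have b: "- B' \<le> F (r k)" for k
    using abs_le_D2[of "F (r k)" B'] by simp
  have "- B' \<le> \<mu> i" for i
    using b[of i] ge[of "r i"] decseqD[OF dec seq_suble[OF r(1), of i]] by simp
  then obtain m where m: "\<mu> \<longlonglongrightarrow> m"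
    using decseq_convergent[OF dec] by metis
  show thesis
  proof (cases rule)
    case (Average_Rule p)
    then have \<mu>: "\<mu> = (\<lambda>i. average_level p F (Suc i))"
      by (simp add: \<mu>_def fun_eq_iff)
    have "(\<lambda>i. \<mu> i - F (Suc i)) \<longlonglongrightarrow> 0"
      using average_level_gap_tendsto_0[OF _ m[unfolded \<mu>]] assms(5) Average_Rule by (simp add: \<mu>)
    then have "(\<lambda>k. \<mu> (r k) - F (Suc (r k))) \<longlonglongrightarrow> 0"
      using LIMSEQ_subseq_LIMSEQ[OF _ r(1)] by (fastforce simp: o_def)
    then show thesis
      by (intro that[of "\<lambda>k. k"]) (auto simp: F \<mu>_def F_def strict_mono_def)
  next
    case (Max_Rule l)
    obtain s j where s: "strict_mono s" "(\<lambda>k. F (Suc (r (s k) + j))) \<longlonglongrightarrow> m"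
      using max_level_attained_at_fixed_delay[OF _ r(1)] m Max_Rule unfolding \<mu>_def by blast
    have rs: "strict_mono (\<lambda>k. r (s k))"
      using strict_mono_o[OF r(1) s(1)] by (simp add: o_def)
    have "(\<lambda>k. X (r (s k))) \<longlonglongrightarrow> x"
      using LIMSEQ_subseq_LIMSEQ[OF r(2) s(1)] by (simp add: o_def)
    then have "bounded (range (\<lambda>k. X (r (s k))))"
      by (rule convergent_imp_bounded)
    then have "bounded (range (\<lambda>k. X (r (s k) + i)))" for i
      using step
      by (intro bounded_shifted_subsequence[where X = X and r = "\<lambda>k. r (s k)" and a = 0,
            OF assms(1) contg X _ assms(7)]) (auto simp: dist_norm)
    then have "(\<lambda>k. \<mu> (r (s k)) - f (X (Suc (r (s k))))) \<longlonglongrightarrow> 0"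
      using s(2)
      by (intro level_gap_tendsto_0_of_later[OF assms(1) contf X _ gap' m rs]) (auto simp: F_def)
    with s(1) show thesis
      by (intro that) (auto simp: F \<mu>_def)
  qed
qed

section \<open>Accumulation points\<close>

lemma P_stationary_accumulation_point:
  fixes C :: "'a::euclidean_space set" and f :: "'a \<Rightarrow> real"
  assumes "closed C" and contg: "continuous_on C (grad f)"
    and u: "\<And>k. u k \<in> C" "u \<longlonglongrightarrow> x"
    and y: "\<And>k. y k \<in> projection C (u k - \<alpha> k *\<^sub>R grad f (u k))"
    and close: "(\<lambda>k. y k - u k) \<longlonglongrightarrow> 0"
    and \<alpha>: "\<And>k. \<alpha> k \<le> b" and "0 < a" and "\<forall>\<^sub>F k in sequentially. a \<le> \<alpha> k"
  shows "P_stationary C f x"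
proof -
  have "x \<in> C"
    using closed_sequentially[OF assms(1) u] .
  obtain n where n: "\<And>k. n \<le> k \<Longrightarrow> a \<le> \<alpha> k"
    using assms(9) by (auto simp: eventually_sequentially)
  have "compact {a..b}" "\<And>k. \<alpha> (k + n) \<in> {a..b}"
    using n \<alpha> by auto
  then obtain s a' where "a' \<in> {a..b}" and s: "strict_mono s" "((\<lambda>k. \<alpha> (k + n)) \<circ> s) \<longlonglongrightarrow> a'"
    unfolding compact_def by metis
  define t where "t k = s k + n" for k
  have t: "strict_mono t"
    using s(1) by (simp add: t_def strict_mono_def)
  have \<alpha>t: "(\<lambda>k. \<alpha> (t k)) \<longlonglongrightarrow> a'"
    using s(2) by (simp add: t_def o_def)
  have ut: "(\<lambda>k. u (t k)) \<longlonglongrightarrow> x"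
    using LIMSEQ_subseq_LIMSEQ[OF u(2) t] by (simp add: o_def)
  have gt: "(\<lambda>k. grad f (u (t k))) \<longlonglongrightarrow> grad f x"
    using continuous_on_tendsto_compose[OF contg ut \<open>x \<in> C\<close>] u by simp
  have "(\<lambda>k. y (t k) - u (t k)) \<longlonglongrightarrow> 0"
    using LIMSEQ_subseq_LIMSEQ[OF close t] by (simp add: o_def)
  from tendsto_add[OF this ut] have yt: "(\<lambda>k. y (t k)) \<longlonglongrightarrow> x"
    by simp
  have "x \<in> projection C (x - a' *\<^sub>R grad f x)"
    by (rule projection_limit[OF assms(1) y[of "t k" for k] _ yt]) (intro tendsto_intros ut \<alpha>t gt)
  then show ?thesis
    using \<open>a' \<in> {a..b}\<close> assms(8) by (intro P_stationaryI[of a']) auto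
qed

theorem theorem1p2:
  fixes C :: "'a::euclidean_space set"
    and f :: "'a \<Rightarrow> real"
    and \<alpha>min \<alpha>max \<beta> c :: real
    and rule :: pgd_rule
    and X :: "nat \<Rightarrow> 'a"
    and N :: enat
  assumes "C \<noteq> {}" and "closed C"
    and "continuously_differentiable_on C f"
    and "0 < \<alpha>min" and "\<alpha>min \<le> \<alpha>max"
    and "0 < \<beta>" and "\<beta> < 1" and "0 < c" and "c < 1"
    and "valid_rule rule"
    and "pgd_sequence C f \<alpha>min \<alpha>max \<beta> c rule X N"
  shows "(\<forall>n. N = enat n \<longrightarrow>
            B_stationary C f (X n) \<and>
            (locally_lipschitz_gradient f \<longrightarrow> P_stationary C f (X n))) \<and>
         (N = \<infinity> \<longrightarrow>
            (\<forall>x. accumulation_point X x \<longrightarrow>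
               B_stationary C f x \<and>
               (locally_lipschitz_gradient f \<longrightarrow> P_stationary C f x)))"
proof -
  let ?\<mu> = "pgd_level rule (\<lambda>j. f (X j))"
  have X0: "X 0 \<in> C"
    and X_Suc: "\<And>i. enat i < N \<Longrightarrow> X (Suc i) \<in> pgd_map C f \<alpha>min \<alpha>max \<beta> c (X i) (?\<mu> i)"
    and stop: "\<And>n. N = enat n \<Longrightarrow> pgd_stop C f (X n)"
    using assms(11) by (auto simp: pgd_sequence_def)
  have XC: "X i \<in> C" if "enat i \<le> N" for i
  proof (cases i)
    case (Suc j)
    with that have "enat j < N"
      by (metis Suc_ile_eq)
    then show ?thesis
      using X_Suc[of j] Suc by (auto simp: pgd_map_def projection_iff dest: pgd_trial_projection)
  qed (use X0 in simp)
  have "B_stationary C f (X n) \<and> (locally_lipschitz_gradient f \<longrightarrow> P_stationary C f (X n))"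
    if "N = enat n" for n
  proof (cases "locally_lipschitz_gradient f")
    case True
    then have "P_stationary C f (X n)"
      using stop[OF that] XC that by (simp add: pgd_stop_def P_stationary_def)
    then show ?thesis
      by (simp add: P_stationary_imp_B_stationary)
  next
    case False
    then show ?thesis
      using stop[OF that] XC that by (simp add: pgd_stop_def B_stationary_def)
  qed
  moreover have "B_stationary C f x \<and> (locally_lipschitz_gradient f \<longrightarrow> P_stationary C f x)"
    if N: "N = \<infinity>" and acc: "accumulation_point X x" for x
  proof -
    have XC: "X i \<in> C" for i
      using XC N by simp
    have contf: "continuous_on C f" and contg: "continuous_on C (grad f)"
      using assms(3) continuously_differentiable_on_imp_continuous_on
      by (auto simp: continuously_differentiable_on_def)
    have "\<exists>\<alpha>. pgd_trial C f \<alpha>min \<alpha>max \<beta> c (X i) (?\<mu> i) \<alpha> (X (Suc i)) \<and>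
        f (X (Suc i)) \<le> ?\<mu> i + c * (grad f (X i) \<bullet> (X (Suc i) - X i))" for i
      using X_Suc[of i] N by (auto simp: pgd_map_def not_less)
    then obtain \<alpha> where trial: "\<And>i. pgd_trial C f \<alpha>min \<alpha>max \<beta> c (X i) (?\<mu> i) (\<alpha> i) (X (Suc i))"
      and accept: "\<And>i. f (X (Suc i)) \<le> ?\<mu> i + c * (grad f (X i) \<bullet> (X (Suc i) - X i))"
      by metis
    have \<alpha>: "0 < \<alpha> i" "\<alpha> i \<le> \<alpha>max" for i
      using pgd_trial_step_bounds[OF trial[of i] assms(4,6,7)] by auto
    note proj = pgd_trial_projection[OF trial]
    have slope: "grad f (X i) \<bullet> (X (Suc i) - X i) \<le> 0" for i
      by (rule projected_step_descent[OF proj XC \<alpha>(1)])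
    have desc: "f (X (Suc i)) \<le> ?\<mu> i" for i
      using accept[of i] mult_nonneg_nonpos[OF less_imp_le[OF assms(8)] slope[of i]] by linarith
    have step: "norm (X (Suc i) - X i) \<le> 2 * \<alpha>max * norm (grad f (X i))" for i
      using projected_step_norm_le[OF proj XC less_imp_le[OF \<alpha>(1)], of i]
        mult_right_mono[of "2 * \<alpha> i" "2 * \<alpha>max" "norm (grad f (X i))"] \<alpha>(2)[of i] by simp
    have gap: "(norm (X (Suc i) - X i))\<^sup>2 \<le> (2 * \<alpha>max / c) * (?\<mu> i - f (X (Suc i)))" for i
    proof -
      have "(norm (X (Suc i) - X i))\<^sup>2 \<le> 2 * \<alpha> i * - (grad f (X i) \<bullet> (X (Suc i) - X i))"
        by (rule projected_step_sq_le[OF proj XC])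
      also have "\<dots> \<le> 2 * \<alpha>max * ((?\<mu> i - f (X (Suc i))) / c)"
        using \<alpha>(1,2)[of i] slope[of i] accept[of i] assms(8)
        by (intro mult_mono) (auto simp: field_simps)
      finally show ?thesis
        by simp
    qed
    obtain r where r: "strict_mono r" "(\<lambda>k. X (r k)) \<longlonglongrightarrow> x"
      using acc by (auto simp: accumulation_point_def o_def)
    obtain s where s: "strict_mono s" "(\<lambda>k. ?\<mu> (r (s k)) - f (X (Suc (r (s k))))) \<longlonglongrightarrow> 0"
      by (rule level_gap_subsequence[OF assms(2) contf contg XC assms(10) step _ desc gap r])
        (use assms(4,5) in auto)
    have Xs: "(\<lambda>k. X (r (s k))) \<longlonglongrightarrow> x"
      using LIMSEQ_subseq_LIMSEQ[OF r(2) s(1)] by (simp add: o_def)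
    have "x \<in> C"
      using closed_sequentially[OF assms(2) _ r(2)] XC by simp
    have "(\<lambda>k. (2 * \<alpha>max / c) * (?\<mu> (r (s k)) - f (X (Suc (r (s k)))))) \<longlonglongrightarrow> (2 * \<alpha>max / c) * 0"
      using s(2) by (intro tendsto_intros)
    then have "(\<lambda>k. (2 * \<alpha>max / c) * (?\<mu> (r (s k)) - f (X (Suc (r (s k)))))) \<longlonglongrightarrow> 0"
      by simp
    then have "(\<lambda>k. (norm (X (Suc (r (s k))) - X (r (s k))))\<^sup>2) \<longlonglongrightarrow> 0"
      by (rule Lim_null_comparison[rotated]) (use gap in simp)
    then have "(\<lambda>k. norm (X (Suc (r (s k))) - X (r (s k)))) \<longlonglongrightarrow> 0"
      using tendsto_real_sqrt by fastforce
    then have close: "(\<lambda>k. X (Suc (r (s k))) - X (r (s k))) \<longlonglongrightarrow> 0"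
      by (rule tendsto_norm_zero_cancel)
    \<comment> \<open>A window of acceptable step sizes near \<open>x\<close> already forces \<open>x\<close> to be P-stationary; the two cases
      below differ only in where the window comes from.\<close>
    have P: "P_stationary C f x" if "0 < \<tau>" "\<tau> \<le> \<alpha>min" "0 < \<rho>"
      and Armijo: "\<And>u \<alpha> y. \<lbrakk>u \<in> C; dist u x < \<rho>; \<alpha> \<in> {\<beta> * \<tau>..\<tau>}; y \<in> projection C (u - \<alpha> *\<^sub>R grad f u)\<rbrakk>
        \<Longrightarrow> f y \<le> f u + c * (grad f u \<bullet> (y - u))" for \<tau> \<rho>
    proof (rule P_stationary_accumulation_point[OF assms(2) contg XC Xs proj close \<alpha>(2)])
      show "0 < \<beta> * \<tau>"
        using that(1) assms(6) by simp
      have "\<forall>\<^sub>F k in sequentially. dist (X (r (s k))) x < \<rho>"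
        using tendstoD[OF Xs that(3)] .
      then show "\<forall>\<^sub>F k in sequentially. \<beta> * \<tau> \<le> \<alpha> (r (s k))"
        by eventually_elim
          (rule pgd_trial_ge[OF trial assms(6,7) that(1,2) pgd_level_ge[OF assms(10) desc] Armijo[OF XC]])
    qed
    have "B_stationary C f x"
    proof (rule ccontr)
      assume nB: "\<not> B_stationary C f x"
      obtain \<tau> \<rho> where "0 < \<tau>" "\<tau> \<le> \<alpha>min" "0 < \<rho>"
        "\<And>u \<alpha> y. \<lbrakk>u \<in> C; dist u x < \<rho>; \<alpha> \<in> {\<beta> * \<tau>..\<tau>}; y \<in> projection C (u - \<alpha> *\<^sub>R grad f u)\<rbrakk>
          \<Longrightarrow> f y \<le> f u + c * (grad f u \<bullet> (y - u))"
        by (rule Armijo_near_nonstationary_point[OF assms(2,3) \<open>x \<in> C\<close> nB assms(6,9,4)]) (rule that)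
      then have "P_stationary C f x"
        by (rule P)
      with nB show False
        using P_stationary_imp_B_stationary by blast
    qed
    moreover have "P_stationary C f x" if LL: "locally_lipschitz_gradient f"
    proof -
      obtain \<tau> \<rho> where \<tau>: "0 < \<tau>" "\<tau> \<le> \<alpha>min" "0 < \<rho>"
        and Armijo: "\<And>u \<alpha> y. \<lbrakk>u \<in> C; dist u x < \<rho>; \<alpha> \<in> {0<..\<tau>}; y \<in> projection C (u - \<alpha> *\<^sub>R grad f u)\<rbrakk>
          \<Longrightarrow> f y \<le> f u + c * (grad f u \<bullet> (y - u))"
        by (rule Armijo_locally_lipschitz_gradient[OF LL contg \<open>x \<in> C\<close> assms(9,4)]) (rule that)
      have "{\<beta> * \<tau>..\<tau>} \<subseteq> {0<..\<tau>}"
        using less_le_trans[OF mult_pos_pos[OF assms(6) \<tau>(1)]] by auto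
      then show ?thesis
        by (intro P[OF \<tau>] Armijo) auto
    qed
    ultimately show ?thesis
      by blast
  qed
  ultimately show ?thesis
    by blast
qed

end
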